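(* Let $k\ge 1$ be an integer and let $G$ be a finite simple graph with $n\ge 2$ vertices and $m$ edges such that $\tau(G)\geq k$. Then $rmc_k(G)\leq m-k(n-2)+n_G$.
   Context: For a simple graph $G$ and distinct vertices $u,v$, $n_{uv}$ is the number of common neighbors of $u$ and $v$, and $n_G=\min\{n_{uv}: u,v\in V(G),\ u\neq v\}$. An edge-coloring of a graph assigns a color to each edge; adjacent edges may receive the same color. A path is monochromatic if all its edges have the same color. For distinct vertices $u,v$ of an edge-colored graph, $k$ rainbow monochromatic $uv$-paths are $k$ edge-disjoint monochromatic $uv$-paths whose colors are pairwise different. An edge-coloring of $G$ is an $RMC_k$-coloring if every two distinct vertices of $G$ are connected by at least $k$ rainbow monochromatic paths. For a graph $G$ having an $RMC_k$-coloring, $rmc_k(G)$ is the maximum number of colors used in an $RMC_k$-coloring of $G$. For a partition $\mathcal{P}=\{V_1,\dots,V_t\}$ of $V(G)$ into nonempty sets, $G/\mathcal{P}$ is the graph obtained by deleting, for each $i$, all edges with both ends in $V_i$ and merging the vertices of $V_i$ into a single vertex (parallel edges are kept). Here $|G/\mathcal P|=|\mathcal P|$ is the number of vertices and $e(G/\mathcal P)$ the number of edges of $G/\mathcal P$. Define $\tau(G)=\min_{|\mathcal{P}|\geq 2}\frac{e(G/\mathcal{P})}{|G/\mathcal{P}|-1}$, the minimum being over all partitions of $V(G)$ with at least two parts. (A graph with $\tau(G)\ge k$ has an $RMC_k$-coloring, so $rmc_k(G)$ is defined.) *)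

theory Defs
  imports Complex_Main "HOL-Library.Disjoint_Sets"
begin

definition simple_graph :: "'a set \<Rightarrow> 'a set set \<Rightarrow> bool" where
  "simple_graph V E \<longleftrightarrow> finite V \<and> (\<forall>e\<in>E. e \<subseteq> V \<and> card e = 2)"

definition num_common_nbrs :: "'a set \<Rightarrow> 'a set set \<Rightarrow> 'a \<Rightarrow> 'a \<Rightarrow> nat" where
  "num_common_nbrs V E u v = card {w\<in>V. {u, w} \<in> E \<and> {v, w} \<in> E}"

definition min_common_nbrs :: "'a set \<Rightarrow> 'a set set \<Rightarrow> nat" where
  "min_common_nbrs V E = Min {num_common_nbrs V E u v |u v. u \<in> V \<and> v \<in> V \<and> u \<noteq> v}"

definition path_edges :: "'a list \<Rightarrow> 'a set set" where
  "path_edges p = {{p ! i, p ! Suc i} |i. Suc i < length p}"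

definition uv_path :: "'a set \<Rightarrow> 'a set set \<Rightarrow> 'a \<Rightarrow> 'a \<Rightarrow> 'a list \<Rightarrow> bool" where
  "uv_path V E u v p \<longleftrightarrow>
     p \<noteq> [] \<and> hd p = u \<and> last p = v \<and> distinct p \<and> set p \<subseteq> V \<and> path_edges p \<subseteq> E"

text \<open>An edge-colouring is a function \<open>\<chi>\<close> of which only the values on the edge set matter;
  it need not be proper.\<close>

definition monochromatic :: "('a set \<Rightarrow> 'c) \<Rightarrow> 'a list \<Rightarrow> bool" where
  "monochromatic \<chi> p \<longleftrightarrow> (\<exists>c. \<forall>e\<in>path_edges p. \<chi> e = c)"

text \<open>Used only for \<open>u \<noteq> v\<close>: every path then has an edge, so distinct members of a family
  of monochromatic paths have well-defined colours, and these are required to differ.\<close>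

definition rainbow_mono_paths ::
  "'a set \<Rightarrow> 'a set set \<Rightarrow> ('a set \<Rightarrow> 'c) \<Rightarrow> 'a \<Rightarrow> 'a \<Rightarrow> 'a list set \<Rightarrow> bool" where
  "rainbow_mono_paths V E \<chi> u v P \<longleftrightarrow>
     finite P \<and>
     (\<forall>p\<in>P. uv_path V E u v p \<and> monochromatic \<chi> p) \<and>
     (\<forall>p\<in>P. \<forall>q\<in>P. p \<noteq> q \<longrightarrow>
        path_edges p \<inter> path_edges q = {} \<and>
        (\<forall>e\<in>path_edges p. \<forall>f\<in>path_edges q. \<chi> e \<noteq> \<chi> f))"

definition RMC_coloring :: "nat \<Rightarrow> 'a set \<Rightarrow> 'a set set \<Rightarrow> ('a set \<Rightarrow> 'c) \<Rightarrow> bool" where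
  "RMC_coloring k V E \<chi> \<longleftrightarrow>
     (\<forall>u\<in>V. \<forall>v\<in>V. u \<noteq> v \<longrightarrow> (\<exists>P. rainbow_mono_paths V E \<chi> u v P \<and> k \<le> card P))"

text \<open>Colours are natural numbers, which is no restriction for a finite edge set. The supremum
  is over a set of numbers bounded by \<open>card E\<close>, so it is the maximum whenever an
  \<open>RMC\<^sub>k\<close>-colouring exists; otherwise it takes the junk value 0.\<close>

definition rmc :: "nat \<Rightarrow> 'a set \<Rightarrow> 'a set set \<Rightarrow> nat" where
  "rmc k V E = Sup {card (\<chi> ` E) |\<chi> :: 'a set \<Rightarrow> nat. RMC_coloring k V E \<chi>}"

text \<open>The edges of \<open>G/P\<close>, each represented by the edge of \<open>G\<close> it comes from, so that parallel
  edges are kept apart. The vertices of \<open>G/P\<close> are the parts in \<open>P\<close>.\<close>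

definition quotient_edges :: "'a set set \<Rightarrow> 'a set set \<Rightarrow> 'a set set" where
  "quotient_edges E P = {e\<in>E. \<not> (\<exists>X\<in>P. e \<subseteq> X)}"

definition tau :: "'a set \<Rightarrow> 'a set set \<Rightarrow> real" where
  "tau V E = Min {real (card (quotient_edges E P)) / (real (card P) - 1) |P.
                    partition_on V P \<and> card P \<ge> 2}"

end

theory Submission
  imports Defs
begin

text \<open>
  The bound holds for every \<open>RMC\<^sub>k\<close>-colouring \<open>\<chi>\<close> and every pair of distinct vertices
  \<open>u, v\<close>, with the number of their common neighbours in place of \<open>n\<^sub>G\<close>; the theorem
  follows by choosing a pair that attains \<open>n\<^sub>G\<close>.  If the colour \<open>c\<close> is used on \<open>e\<^sub>c\<close> edges,
  the number of edges minus the number of colours is the sum of all \<open>e\<^sub>c - 1\<close>, so the task is to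
  bound this waste from below by \<open>k (n - 2) - n\<^sub>u\<^sub>v\<close>.

  Let \<open>U\<^sub>c\<close> be the union of the components of \<open>u\<close> and of \<open>v\<close> in the graph of colour \<open>c\<close>.
  A connected set of \<open>r\<close> vertices spans at least \<open>r - 1\<close> edges.  Hence \<open>e\<^sub>c - 1\<close> is at least the
  number of vertices of \<open>U\<^sub>c\<close> other than \<open>u, v\<close>, with one unit lost when \<open>c\<close> occurs at \<open>u\<close> or at \<open>v\<close>
  without joining them (\<open>color_class_waste\<close>).  Call such a colour split.

  Summing over the colours and exchanging the order of summation, each vertex \<open>w\<close> other than
  \<open>u, v\<close> contributes the number of colours joining it to \<open>u\<close> or to \<open>v\<close>, and the split colours
  on the edges \<open>uw\<close> and \<open>vw\<close> are charged to \<open>w\<close>.  At least \<open>k\<close> colours join \<open>w\<close> to \<open>u\<close>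
  and at least \<open>k\<close> join it to \<open>v\<close>.  A split colour on \<open>uw\<close> joins \<open>w\<close> to \<open>u\<close> but not to \<open>v\<close>, so
  it is an additional colour besides the \<open>k\<close> colours towards \<open>v\<close>, and symmetrically for \<open>vw\<close>.  This
  pays for one charge; a second charge occurs only if \<open>w\<close> is a common neighbour of \<open>u\<close> and \<open>v\<close>
  (\<open>vertex_charge\<close>).  So, after the charges, \<open>w\<close> contributes at least \<open>k\<close>, or \<open>k - 1\<close> for a
  common neighbour.

  The hypothesis on \<open>\<tau>\<close> enters through the partition into singletons, which gives
  \<open>k (n - 1) \<le> m\<close>.  This makes the right-hand side nonnegative, as is required if the set of
  \<open>RMC\<^sub>k\<close>-colourings is empty and its supremum is by convention \<open>0\<close>.
\<close>

section \<open>Components of a set of edges\<close>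

lemma simple_graph_finite_edges:
  assumes "simple_graph V E"
  shows "finite E"
proof (rule finite_subset)
  show "E \<subseteq> Pow V" using assms by (auto simp: simple_graph_def)
qed (use assms in \<open>simp add: simple_graph_def\<close>)

definition adjacency :: "'a set set \<Rightarrow> ('a \<times> 'a) set" where
  "adjacency F = {(a, b). {a, b} \<in> F}"

definition component :: "'a set set \<Rightarrow> 'a \<Rightarrow> 'a set" where
  "component F x = (adjacency F)\<^sup>* `` {x}"

lemma component_self: "x \<in> component F x"
  by (simp add: component_def)

lemma component_step: "y \<in> component F x \<Longrightarrow> {y, z} \<in> F \<Longrightarrow> z \<in> component F x"
  unfolding component_def adjacency_def by (auto intro: rtrancl_into_rtrancl)

lemma component_edge: "{x, y} \<in> F \<Longrightarrow> y \<in> component F x"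
  by (rule component_step[OF component_self])

lemma component_eq:
  assumes "y \<in> component F x"
  shows "component F y = component F x"
proof -
  have "sym (adjacency F)"
    by (auto simp: sym_def adjacency_def insert_commute)
  then have "sym ((adjacency F)\<^sup>*)"
    by (rule sym_rtrancl)
  then show ?thesis
    using assms unfolding component_def by (auto dest: symD intro: rtrancl_trans)
qed

lemma component_subset:
  assumes "x \<in> A" and "\<And>a b. a \<in> A \<Longrightarrow> {a, b} \<in> F \<Longrightarrow> b \<in> A"
  shows "component F x \<subseteq> A"
proof
  fix y assume "y \<in> component F x"
  then have "(x, y) \<in> (adjacency F)\<^sup>*" by (simp add: component_def)
  then show "y \<in> A"
    by (induction rule: rtrancl_induct) (use assms in \<open>auto simp: adjacency_def\<close>)
qed

lemma components_disjoint:
  assumes "v \<notin> component F u"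
  shows "component F u \<inter> component F v = {}"
proof (rule ccontr)
  assume "component F u \<inter> component F v \<noteq> {}"
  then obtain w where "w \<in> component F u" "w \<in> component F v" by auto
  then have "component F u = component F v" using component_eq by metis
  then show False using assms component_self by metis
qed

text \<open>A connected set of vertices can be built up from any one of them by adding one vertex at a
  time; each added vertex brings at least one new edge.\<close>

lemma card_component_le:
  assumes "finite F" "finite (component F x)"
  shows "card (component F x) \<le> card {e \<in> F. e \<subseteq> component F x} + 1"
proof -
  let ?R = "component F x"
  have grow: "\<exists>A. A \<subseteq> ?R \<and> x \<in> A \<and> card A = Suc j \<and> j \<le> card {e \<in> F. e \<subseteq> A}"
    if "Suc j \<le> card ?R" for j
    using that
  proof (induction j)
    case 0
    show ?case by (rule exI[of _ "{x}"]) (simp add: component_self)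
  next
    case (Suc j)
    then obtain A where A: "A \<subseteq> ?R" "x \<in> A" "card A = Suc j"
        "j \<le> card {e \<in> F. e \<subseteq> A}" by auto
    have finA: "finite A" using A(1) assms(2) by (rule finite_subset)
    have "\<not> ?R \<subseteq> A" using A Suc.prems card_mono[OF finA] by fastforce
    then obtain a b where ab: "a \<in> A" "b \<notin> A" "{a, b} \<in> F"
      using component_subset[of x A F] A(2) by blast
    have bR: "b \<in> ?R" using ab A(1) component_step by fastforce
    have "insert {a, b} {e \<in> F. e \<subseteq> A} \<subseteq> {e \<in> F. e \<subseteq> insert b A}"
      using ab by auto
    then have "card (insert {a, b} {e \<in> F. e \<subseteq> A}) \<le> card {e \<in> F. e \<subseteq> insert b A}"
      using assms(1) by (intro card_mono) auto
    moreover have "card (insert {a, b} {e \<in> F. e \<subseteq> A}) = Suc (card {e \<in> F. e \<subseteq> A})"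
      using assms(1) ab by (subst card_insert_disjoint) auto
    ultimately show ?case
      using A ab bR finA by (intro exI[of _ "insert b A"]) auto
  qed
  have "card ?R > 0" using assms(2) component_self[of x F] card_gt_0_iff by blast
  then obtain A where A: "A \<subseteq> ?R" "card A = card ?R"
      "card ?R - 1 \<le> card {e \<in> F. e \<subseteq> A}"
    using grow[of "card ?R - 1"] by auto
  have "A = ?R" using A card_subset_eq[OF assms(2)] by blast
  then show ?thesis using A by simp
qed

section \<open>Waste of a single colour\<close>

text \<open>Applied to the colour classes \<open>F\<close>.  The unit is lost because two disjoint components need
  one edge less than a connected set of the same size.  If \<open>F\<close> has no edge at \<open>u\<close> or \<open>v\<close>,
  nothing is lost, since both components are trivial while \<open>F\<close> still has an edge elsewhere.\<close>

lemma color_class_waste: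
  assumes F: "simple_graph V F" "F \<noteq> {}" and uv: "u \<in> V" "v \<in> V" "u \<noteq> v"
  shows "card {w \<in> V - {u, v}. w \<in> component F u \<union> component F v} + 1 \<le>
         card F + of_bool (v \<notin> component F u \<and> (\<exists>w. {u, w} \<in> F \<or> {v, w} \<in> F))"
proof -
  let ?U = "component F u \<union> component F v"
  have finF: "finite F" using F(1) by (rule simple_graph_finite_edges)
  have sub: "component F x \<subseteq> V" if "x \<in> V" for x
    using that F(1) by (intro component_subset) (auto simp: simple_graph_def)
  then have fin: "finite (component F u)" "finite (component F v)"
    using F(1) finite_subset[OF sub[OF uv(1)]] finite_subset[OF sub[OF uv(2)]]
    by (simp_all add: simple_graph_def)
  have "{w \<in> V - {u, v}. w \<in> ?U} = ?U - {u, v}"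
    using sub uv by auto
  moreover have uvU: "{u, v} \<subseteq> ?U"
    using component_self[of u F] component_self[of v F] by auto
  ultimately have card_eq: "card {w \<in> V - {u, v}. w \<in> ?U} + 2 = card ?U"
    using card_Diff_subset[of "{u, v}" ?U] card_mono[of ?U "{u, v}"] uv(3) fin by simp
  show ?thesis
  proof (cases "v \<in> component F u")
    case True
    then have "?U = component F u" using component_eq[OF True] by blast
    moreover have "card {e \<in> F. e \<subseteq> component F u} \<le> card F"
      using finF by (intro card_mono) auto
    ultimately show ?thesis
      using card_eq card_component_le[OF finF fin(1)] by simp
  next
    case False
    note disj = components_disjoint[OF False]
    let ?Eu = "{e \<in> F. e \<subseteq> component F u}"
    let ?Ev = "{e \<in> F. e \<subseteq> component F v}"
    show ?thesis
    proof (cases "\<exists>w. {u, w} \<in> F \<or> {v, w} \<in> F")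
      case True
      have "{} \<notin> F" using F(1) by (auto simp: simple_graph_def)
      moreover have "e = {}" if "e \<in> ?Eu \<inter> ?Ev" for e
        using that disj by blast
      ultimately have "?Eu \<inter> ?Ev = {}" by blast
      then have "card ?Eu + card ?Ev = card (?Eu \<union> ?Ev)"
        using finF by (intro card_Un_disjoint[symmetric]) auto
      also have "\<dots> \<le> card F" using finF by (intro card_mono) auto
      finally have "card ?Eu + card ?Ev \<le> card F" .
      moreover have "card ?U = card (component F u) + card (component F v)"
        using fin disj by (rule card_Un_disjoint)
      ultimately have "card ?U \<le> card F + 2"
        using card_component_le[OF finF fin(1)] card_component_le[OF finF fin(2)] by linarith
      then show ?thesis using card_eq True False by simp
    next
      case isolated: False
      then have "component F u \<subseteq> {u}" "component F v \<subseteq> {v}"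
        by (intro component_subset; auto)+
      then have "{w \<in> V - {u, v}. w \<in> ?U} = {}" by auto
      moreover have "card F > 0" using finF F(2) by (simp add: card_gt_0_iff)
      ultimately show ?thesis by (simp only: card.empty)
    qed
  qed
qed

section \<open>Charging the split colours\<close>

abbreviation color_class :: "'a set set \<Rightarrow> ('a set \<Rightarrow> 'c) \<Rightarrow> 'c \<Rightarrow> 'a set set" where
  "color_class E \<chi> c \<equiv> {e \<in> E. \<chi> e = c}"

definition joining_colors :: "'a set set \<Rightarrow> ('a set \<Rightarrow> 'c) \<Rightarrow> 'a \<Rightarrow> 'a \<Rightarrow> 'c set" where
  "joining_colors E \<chi> u w = {c \<in> \<chi> ` E. w \<in> component (color_class E \<chi> c) u}"

lemma path_component:
  assumes "path_edges p \<subseteq> F" "p \<noteq> []"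
  shows "last p \<in> component F (hd p)"
proof -
  have "p ! i \<in> component F (p ! 0)" if "i < length p" for i
    using that
  proof (induction i)
    case 0
    show ?case by (rule component_self)
  next
    case (Suc i)
    then have "{p ! i, p ! Suc i} \<in> F"
      using assms(1) by (auto simp: path_edges_def)
    then show ?case using Suc component_step by force
  qed
  then show ?thesis using assms(2) by (simp add: hd_conv_nth last_conv_nth)
qed

lemma card_rainbow_mono_paths_le:
  assumes "rainbow_mono_paths V E \<chi> u w P" "u \<noteq> w" "finite E"
  shows "card P \<le> card (joining_colors E \<chi> u w)"
proof -
  have "\<exists>e \<in> path_edges p. e \<in> E \<and> path_edges p \<subseteq> color_class E \<chi> (\<chi> e)" if "p \<in> P" for p
  proof -
    have p: "p \<noteq> []" "hd p = u" "last p = w" "path_edges p \<subseteq> E" "monochromatic \<chi> p"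
      using that assms(1) by (auto simp: rainbow_mono_paths_def uv_path_def)
    then have "Suc 0 < length p" using assms(2) by (cases p) auto
    then have "{p ! 0, p ! Suc 0} \<in> path_edges p" by (auto simp: path_edges_def)
    then show ?thesis using p by (fastforce simp: monochromatic_def)
  qed
  then obtain f where f: "\<And>p. p \<in> P \<Longrightarrow> f p \<in> path_edges p \<and> f p \<in> E \<and>
      path_edges p \<subseteq> color_class E \<chi> (\<chi> (f p))" by metis
  have "inj_on (\<lambda>p. \<chi> (f p)) P"
    unfolding inj_on_def using assms(1) f unfolding rainbow_mono_paths_def by metis
  moreover have "(\<lambda>p. \<chi> (f p)) ` P \<subseteq> joining_colors E \<chi> u w"
  proof
    fix c assume "c \<in> (\<lambda>p. \<chi> (f p)) ` P"
    then obtain p where p: "p \<in> P" "c = \<chi> (f p)" by auto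
    have "uv_path V E u w p" using p assms(1) by (auto simp: rainbow_mono_paths_def)
    then have "p \<noteq> []" "hd p = u" "last p = w" by (auto simp: uv_path_def)
    then show "c \<in> joining_colors E \<chi> u w"
      using f[OF p(1)] p(2) path_component[of p "color_class E \<chi> c"]
      by (auto simp: joining_colors_def)
  qed
  ultimately show ?thesis
    using assms(3) by (intro card_inj_on_le[of "\<lambda>p. \<chi> (f p)"]) (auto simp: joining_colors_def)
qed

lemma card_joining_colors_ge:
  assumes "RMC_coloring k V E \<chi>" "finite E" "u \<in> V" "w \<in> V" "u \<noteq> w"
  shows "k \<le> card (joining_colors E \<chi> u w)"
proof -
  obtain P where "rainbow_mono_paths V E \<chi> u w P" "k \<le> card P"
    using assms by (auto simp: RMC_coloring_def)
  then show ?thesis using card_rainbow_mono_paths_le[of V E \<chi> u w P] assms by simp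
qed

text \<open>On the left, \<open>k\<close> is increased by the number of colours charged to \<open>w\<close>.  A charged colour
  on \<open>uw\<close> cannot join \<open>w\<close> to \<open>v\<close>, since it would then join \<open>u\<close> to \<open>v\<close>.  Hence it enlarges
  the union beyond the colours joining \<open>w\<close> to \<open>v\<close>; the case of \<open>vw\<close> is symmetric.\<close>

lemma vertex_charge:
  assumes "finite E"
    and ku: "k \<le> card (joining_colors E \<chi> u w)" and kv: "k \<le> card (joining_colors E \<chi> v w)"
  shows "k + card (\<chi> ` (E \<inter> {{u, w}, {v, w}}) - joining_colors E \<chi> u v) \<le>
         card (joining_colors E \<chi> u w \<union> joining_colors E \<chi> v w) +
         of_bool ({u, w} \<in> E \<and> {v, w} \<in> E)"
proof -
  let ?A = "joining_colors E \<chi> u w" and ?B = "joining_colors E \<chi> v w"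
  let ?S = "joining_colors E \<chi> u v"
  let ?T = "\<chi> ` (E \<inter> {{u, w}, {v, w}}) - ?S"
  have fin: "finite ?A" "finite ?B" using assms(1) by (auto simp: joining_colors_def)
  have inter: "?A \<inter> ?B \<subseteq> ?S"
  proof
    fix c assume c: "c \<in> ?A \<inter> ?B"
    then have "component (color_class E \<chi> c) u = component (color_class E \<chi> c) v"
      using component_eq[of w "color_class E \<chi> c"] by (auto simp: joining_colors_def)
    then show "c \<in> ?S" using c component_self[of v] by (auto simp: joining_colors_def)
  qed
  have edge: "\<chi> {x, w} \<in> joining_colors E \<chi> x w" if "{x, w} \<in> E" for x
    using that by (auto simp: joining_colors_def intro: component_edge)
  have T_sub: "?T \<subseteq> ?A \<union> ?B" using edge by auto
  have gain: "k + 1 \<le> card (?A \<union> ?B)" if "?T \<noteq> {}"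
  proof -
    from that obtain c where c: "c \<in> ?A \<union> ?B" "c \<notin> ?S" using T_sub by auto
    then consider "c \<notin> ?B" | "c \<notin> ?A" using inter by blast
    then show ?thesis
    proof cases
      case 1
      then have "card (insert c ?B) = card ?B + 1" using fin by simp
      moreover have "card (insert c ?B) \<le> card (?A \<union> ?B)"
        using c fin by (intro card_mono) auto
      ultimately show ?thesis using kv by simp
    next
      case 2
      then have "card (insert c ?A) = card ?A + 1" using fin by simp
      moreover have "card (insert c ?A) \<le> card (?A \<union> ?B)"
        using c fin by (intro card_mono) auto
      ultimately show ?thesis using ku by simp
    qed
  qed
  have "k \<le> card (?A \<union> ?B)"
    using ku fin card_mono[of "?A \<union> ?B" ?A] by simp
  moreover have "card ?T \<le> 1 + of_bool ({u, w} \<in> E \<and> {v, w} \<in> E)"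
  proof (cases "{u, w} \<in> E \<and> {v, w} \<in> E")
    case True
    have "card ?T \<le> card {\<chi> {u, w}, \<chi> {v, w}}" by (intro card_mono) auto
    also have "\<dots> \<le> 2" by (simp add: card_insert_if)
    finally show ?thesis using True by simp
  next
    case False
    then obtain x where "?T \<subseteq> {\<chi> {x, w}}" by blast
    then have "card ?T \<le> card {\<chi> {x, w}}" by (intro card_mono) auto
    then show ?thesis by simp
  qed
  moreover have "card ?T = 0 \<or> k + 1 \<le> card (?A \<union> ?B)"
    using gain by (cases "?T = {}") (simp_all only: card.empty simp_thms)
  ultimately show ?thesis by linarith
qed

section \<open>The bound for a pair of vertices\<close>

lemma RMC_coloring_card_colors_le:
  assumes G: "simple_graph V E" and \<chi>: "RMC_coloring k V E \<chi>"
    and uv: "u \<in> V" "v \<in> V" "u \<noteq> v"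
  shows "card (\<chi> ` E) + k * (card V - 2) \<le> card E + num_common_nbrs V E u v"
proof -
  let ?W = "V - {u, v}" and ?C = "\<chi> ` E"
  let ?J = "joining_colors E \<chi>"
  let ?T = "\<lambda>w. \<chi> ` (E \<inter> {{u, w}, {v, w}}) - ?J u v"
  let ?F = "color_class E \<chi>"
  define split where
    "split = {c \<in> ?C. v \<notin> component (?F c) u \<and> (\<exists>w. {u, w} \<in> ?F c \<or> {v, w} \<in> ?F c)}"
  have finE: "finite E" using G by (rule simple_graph_finite_edges)
  have finV: "finite V" using G by (simp add: simple_graph_def)
  have split_sub: "split \<subseteq> (\<Union>w\<in>?W. ?T w)"
  proof
    fix c assume c: "c \<in> split"
    then obtain w where w: "{u, w} \<in> ?F c \<or> {v, w} \<in> ?F c" by (auto simp: split_def)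
    have nuv: "v \<notin> component (?F c) u" using c by (simp add: split_def)
    \<comment> \<open>An edge \<open>uv\<close> of colour \<open>c\<close> would join \<open>u\<close> to \<open>v\<close>, so the other end of the edge
      lies outside \<open>{u, v}\<close> and can be charged.\<close>
    have "{u, v} \<notin> ?F c" using nuv component_edge[of u v "?F c"] by metis
    moreover have "w \<in> V" "{u, u} \<notin> E" "{v, v} \<notin> E"
      using w G by (auto simp: simple_graph_def)
    ultimately have "w \<in> ?W" using w by (auto simp: insert_commute)
    moreover have "c \<in> ?T w" using w nuv by (auto simp: joining_colors_def)
    ultimately show "c \<in> (\<Union>w\<in>?W. ?T w)" by blast
  qed
  have "card split \<le> card (\<Union>w\<in>?W. ?T w)"
    using split_sub finV finE by (intro card_mono) auto
  also have "\<dots> \<le> (\<Sum>w\<in>?W. card (?T w))"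
    using finV by (intro card_UN_le) simp
  finally have card_split: "card split \<le> (\<Sum>w\<in>?W. card (?T w))" .

  have "(\<Sum>c\<in>?C. card {w \<in> ?W. w \<in> component (?F c) u \<union> component (?F c) v} + 1) \<le>
        (\<Sum>c\<in>?C. card (?F c) + of_bool (c \<in> split))"
  proof (rule sum_mono)
    fix c assume c: "c \<in> ?C"
    have "simple_graph V (?F c)" "?F c \<noteq> {}" using G c by (auto simp: simple_graph_def)
    from color_class_waste[OF this uv] show
      "card {w \<in> ?W. w \<in> component (?F c) u \<union> component (?F c) v} + 1 \<le>
       card (?F c) + of_bool (c \<in> split)"
      using c by (simp add: split_def)
  qed
  moreover have "(\<Sum>c\<in>?C. card (?F c)) = card E"
    using finE by (subst card_eq_sum, subst sum.image_gen[of E _ \<chi>]) simp_all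
  moreover have "(\<Sum>c\<in>?C. of_bool (c \<in> split)) = card split"
  proof -
    have "?C \<inter> split = split" by (auto simp: split_def)
    then show ?thesis using finE by simp
  qed
  moreover have "(\<Sum>c\<in>?C. card {w \<in> ?W. w \<in> component (?F c) u \<union> component (?F c) v}) =
      (\<Sum>w\<in>?W. card (?J u w \<union> ?J v w))"
  proof (rule sum_multicount_gen)
    show "\<forall>w\<in>?W. card {c \<in> ?C. w \<in> component (?F c) u \<union> component (?F c) v} =
        card (?J u w \<union> ?J v w)"
      by (auto simp: joining_colors_def intro!: arg_cong[where f = card])
  qed (use finE finV in auto)
  ultimately have colors:
    "(\<Sum>w\<in>?W. card (?J u w \<union> ?J v w)) + card ?C \<le> card E + card split"
    by (simp add: sum.distrib sum_Suc)

  have "(\<Sum>w\<in>?W. k + card (?T w)) \<le>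
      (\<Sum>w\<in>?W. card (?J u w \<union> ?J v w) + of_bool ({u, w} \<in> E \<and> {v, w} \<in> E))"
  proof (rule sum_mono)
    fix w assume "w \<in> ?W"
    then show "k + card (?T w) \<le>
        card (?J u w \<union> ?J v w) + of_bool ({u, w} \<in> E \<and> {v, w} \<in> E)"
      using uv card_joining_colors_ge[OF \<chi> finE]
      by (intro vertex_charge finE) auto
  qed
  moreover have "(\<Sum>w\<in>?W. of_bool ({u, w} \<in> E \<and> {v, w} \<in> E)) = num_common_nbrs V E u v"
  proof -
    have "?W \<inter> {w. {u, w} \<in> E \<and> {v, w} \<in> E} = {w \<in> V. {u, w} \<in> E \<and> {v, w} \<in> E}"
      using G by (auto simp: simple_graph_def)
    then show ?thesis using finV by (simp add: num_common_nbrs_def)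
  qed
  moreover have "card ?W = card V - 2"
    using uv by (subst card_Diff_subset) auto
  ultimately have "k * (card V - 2) + (\<Sum>w\<in>?W. card (?T w)) \<le>
      (\<Sum>w\<in>?W. card (?J u w \<union> ?J v w)) + num_common_nbrs V E u v"
    by (simp add: sum.distrib mult.commute)
  then show ?thesis using colors card_split by linarith
qed

section \<open>The bound for the rainbow monochromatic connection number\<close>

lemma min_common_nbrs_attained:
  assumes "simple_graph V E" "card V \<ge> 2"
  obtains u v where "u \<in> V" "v \<in> V" "u \<noteq> v" "min_common_nbrs V E = num_common_nbrs V E u v"
proof -
  let ?N = "{num_common_nbrs V E u v |u v. u \<in> V \<and> v \<in> V \<and> u \<noteq> v}"
  have "?N \<subseteq> (\<lambda>(u, v). num_common_nbrs V E u v) ` (V \<times> V)" by auto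
  then have "finite ?N"
    by (rule finite_subset) (use assms(1) in \<open>simp add: simple_graph_def\<close>)
  moreover have "?N \<noteq> {}"
  proof -
    obtain S where "S \<subseteq> V" "card S = 2" using obtain_subset_with_card_n[OF assms(2)] by blast
    then show ?thesis by (auto simp: card_2_iff)
  qed
  ultimately have "Min ?N \<in> ?N" by (rule Min_in)
  then show thesis using that by (auto simp: min_common_nbrs_def)
qed

lemma tau_le_edges:
  assumes "simple_graph V E" "card V \<ge> 2"
  shows "tau V E \<le> real (card E) / (real (card V) - 1)"
proof -
  let ?R = "{real (card (quotient_edges E P)) / (real (card P) - 1) |P.
      partition_on V P \<and> card P \<ge> 2}"
  let ?P = "(\<lambda>x. {x}) ` V"
  have finV: "finite V" using assms(1) by (simp add: simple_graph_def)
  have "?R \<subseteq> (\<lambda>P. real (card (quotient_edges E P)) / (real (card P) - 1)) ` Pow (Pow V)"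
    by (auto simp: partition_on_def)
  then have "finite ?R" by (rule finite_subset) (simp add: finV)
  moreover have cardP: "card ?P = card V" by (simp add: card_image inj_on_def)
  have "partition_on V ?P"
    by (rule partition_onI) auto
  then have "real (card (quotient_edges E ?P)) / (real (card ?P) - 1) \<in> ?R"
    using cardP assms(2) by (intro CollectI exI[of _ ?P]) simp
  ultimately have "tau V E \<le> real (card (quotient_edges E ?P)) / (real (card ?P) - 1)"
    unfolding tau_def by (rule Min_le)
  also have "\<dots> \<le> real (card E) / (real (card V) - 1)"
    unfolding cardP using assms simple_graph_finite_edges[OF assms(1)]
    by (intro divide_right_mono) (auto simp: quotient_edges_def intro!: card_mono)
  finally show ?thesis .
qed

theorem proposition4p3:
  fixes V :: "'a set" and E :: "'a set set" and k :: nat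
  assumes "k \<ge> 1"
    and "simple_graph V E"
    and "card V \<ge> 2"
    and "tau V E \<ge> real k"
  shows "int (rmc k V E) \<le>
         int (card E) - int k * (int (card V) - 2) + int (min_common_nbrs V E)"
proof -
  let ?b = "card E + min_common_nbrs V E - k * (card V - 2)"
  let ?X = "{card (\<chi> ` E) |\<chi> :: 'a set \<Rightarrow> nat. RMC_coloring k V E \<chi>}"
  have "real k \<le> real (card E) / (real (card V) - 1)"
    using assms(4) tau_le_edges[OF assms(2,3)] by linarith
  then have "real k * (real (card V) - 1) \<le> real (card E)"
    using assms(3) by (simp add: pos_le_divide_eq)
  then have "real (k * (card V - 1)) \<le> real (card E)"
    using assms(3) by simp
  then have "k * (card V - 1) \<le> card E" by (simp only: of_nat_le_iff)
  moreover have "k * (card V - 2) \<le> k * (card V - 1)" by (intro mult_left_mono) auto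
  ultimately have edges: "k * (card V - 2) \<le> card E" by linarith
  obtain u v where uv: "u \<in> V" "v \<in> V" "u \<noteq> v"
      "min_common_nbrs V E = num_common_nbrs V E u v"
    using min_common_nbrs_attained[OF assms(2,3)] .
  have "rmc k V E \<le> ?b"
  proof (cases "?X = {}")
    case True
    then show ?thesis unfolding rmc_def by (simp only: Sup_nat_empty)
  next
    case False
    then show ?thesis unfolding rmc_def
    proof (rule cSup_least)
      fix x assume "x \<in> ?X"
      then show "x \<le> ?b"
        using RMC_coloring_card_colors_le[OF assms(2) _ uv(1-3)] uv(4) by fastforce
    qed
  qed
  then have "int (rmc k V E) \<le> int ?b" by simp
  also have "int ?b = int (card E) + int (min_common_nbrs V E) - int (k * (card V - 2))"
    using edges by (intro of_nat_diff[THEN trans]) auto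
  also have "int (k * (card V - 2)) = int k * (int (card V) - 2)"
    using assms(3) by simp
  finally show ?thesis by linarith
qed

end
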